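(* For all $j\geq 0$ and $n\geq 0$: $d_{9j+2}(9n+5)\equiv 0\pmod 9$ and $d_{9j+2}(9n+8)\equiv 0\pmod 9$.
   Context: For each integer $k\geq 1$, the numbers $d_k(n)$ are defined by $\sum_{n\geq 0} d_k(n)q^n = \frac{f_2^k}{f_1^{3k+1}}$, where $f_r = \prod_{i\geq 1}(1-q^{ri})$. *)

theory Defs
  imports "HOL-Computational_Algebra.Formal_Power_Series"
begin

(* f_r = prod_{i>=1} (1 - q^(r i)), as a formal power series over the rationals.
   For r >= 1 the n-th coefficient of the infinite product equals the n-th
   coefficient of the finite partial product over i = 1..n. *)
definition qpoch_f :: "nat \<Rightarrow> rat fps" where
  "qpoch_f r = Abs_fps (\<lambda>n. fps_nth (\<Prod>i\<in>{1..n}. (1 - fps_X ^ (r * i))) n)"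

definition d_gen :: "nat \<Rightarrow> rat fps" where
  "d_gen k = qpoch_f 2 ^ k * inverse (qpoch_f 1 ^ (3 * k + 1))"

definition d :: "nat \<Rightarrow> nat \<Rightarrow> rat" where
  "d k n = fps_nth (d_gen k) n"

end

(* Write d_k as the coefficients of C G with C = f_1^2 f_2^2 and, for k = 9 j + 2,
   G = f_2^(9 j) / f_1^(27 j + 9). Since f_r^3 = f_(3 r) mod 3 and f_r^9 = f_(3 r)^3 mod 9,
   G is a series in q^3 modulo 9 and a series in q^9 modulo 3.
   Gauss' identity f_1^2 / f_2 = sum_x (-1)^x q^(x^2) and Jacobi's identity
   f_2^3 = sum_(m >= 0) (-1)^m (2 m + 1) q^(m^2 + m) show that the N-th coefficient of C is
   the sum of (-1)^(x + m) (2 m + 1) over x^2 + m^2 + m = N, that is, over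
   (2 x)^2 + (2 m + 1)^2 = 4 N + 1. If N = 2 mod 3, then 3 divides x and 2 m + 1, so that
   9 divides 4 N + 1: the coefficient is divisible by 3, and it vanishes unless N = 2 mod 9.
   Both identities are limits of finite forms obtained from the q-binomial theorem. *)

theory Submission
  imports Defs "HOL-Computational_Algebra.Polynomial"
begin

unbundle fps_syntax

subsection \<open>Congruences in commutative rings\<close>

text \<open>One relation serves two purposes in rings of power series: congruence modulo 3 or 9, and
  agreement of series up to a power of \<open>fps_X\<close>.\<close>

definition dvd_cong :: "'a::comm_ring_1 \<Rightarrow> 'a \<Rightarrow> 'a \<Rightarrow> bool" where
  "dvd_cong m a b \<longleftrightarrow> m dvd a - b"

lemma dvd_cong_refl [simp]: "dvd_cong m a a"
  by (simp add: dvd_cong_def)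

lemma dvd_cong_sym: "dvd_cong m a b \<Longrightarrow> dvd_cong m b a"
  unfolding dvd_cong_def using dvd_minus_iff[of m "a - b"] by simp

lemma dvd_cong_trans [trans]: "dvd_cong m a b \<Longrightarrow> dvd_cong m b c \<Longrightarrow> dvd_cong m a c"
  unfolding dvd_cong_def using dvd_add[of m "a - b" "b - c"] by simp

lemma dvd_cong_mult: "dvd_cong m a b \<Longrightarrow> dvd_cong m c e \<Longrightarrow> dvd_cong m (a * c) (b * e)"
  unfolding dvd_cong_def mult_diff_mult by (intro dvd_add dvd_mult dvd_mult2)

lemma dvd_cong_power: "dvd_cong m a b \<Longrightarrow> dvd_cong m (a ^ n) (b ^ n)"
  by (induction n) (auto intro: dvd_cong_mult)

lemma dvd_cong_sum: "(\<And>x. x \<in> A \<Longrightarrow> dvd_cong m (f x) (g x)) \<Longrightarrow> dvd_cong m (sum f A) (sum g A)"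
  unfolding dvd_cong_def sum_subtractf[symmetric] by (rule dvd_sum)

lemma dvd_cong_prod: "(\<And>x. x \<in> A \<Longrightarrow> dvd_cong m (f x) (g x)) \<Longrightarrow> dvd_cong m (prod f A) (prod g A)"
  by (induction A rule: infinite_finite_induct) (auto intro: dvd_cong_mult)

text \<open>In the expansion of (b + 3 c)^3 every term but b^3 contains 9, so cubing lifts a
  congruence from 3 to 9.\<close>

lemma dvd_cong_cube_3_9:
  assumes "dvd_cong 3 a b"
  shows "dvd_cong 9 (a ^ 3) (b ^ 3)"
proof -
  obtain c where "a - b = 3 * c" using assms unfolding dvd_cong_def by (elim dvdE)
  then have "a = b + 3 * c" by (simp add: algebra_simps)
  then have "a ^ 3 - b ^ 3 = 9 * (b\<^sup>2 * c + 3 * b * c\<^sup>2 + 3 * c ^ 3)"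
    by (simp add: power2_eq_square power3_eq_cube algebra_simps)
  then show ?thesis unfolding dvd_cong_def by (simp only: dvd_triv_left)
qed

text \<open>Multiplying \<open>b - a ^ 3\<close> by \<open>u ^ 3 * v\<close> gives
  \<open>u ^ 3 - v\<close>. Inverses enter as witnesses because the application is to power series
  over the integers.\<close>

lemma dvd_cong_cube_inverse:
  assumes ab: "dvd_cong m (a ^ 3) b" and u: "a * u = 1" and v: "b * v = 1"
  shows "dvd_cong m (u ^ 3) v"
proof -
  have "u ^ 3 - v = u ^ 3 * (b * v) - (a * u) ^ 3 * v"
    unfolding u v by simp
  also have "\<dots> = (b - a ^ 3) * (u ^ 3 * v)"
    by (simp add: algebra_simps power_mult_distrib)
  finally show ?thesis using dvd_cong_sym[OF ab] unfolding dvd_cong_def by simp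
qed

subsection \<open>The finite q-binomial theorem\<close>

text \<open>The q-Pascal recursion replaces a quotient of products: it makes sense in every
  commutative ring, so \<open>q\<close> may later be a power series or a constant
  polynomial.\<close>

fun gauss_binomial :: "'a::comm_ring_1 \<Rightarrow> nat \<Rightarrow> nat \<Rightarrow> 'a" where
  "gauss_binomial q n 0 = 1"
| "gauss_binomial q 0 (Suc k) = 0"
| "gauss_binomial q (Suc n) (Suc k) =
     gauss_binomial q n k + q ^ Suc k * gauss_binomial q n (Suc k)"

lemma gauss_binomial_eq_0: "n < k \<Longrightarrow> gauss_binomial q n k = 0"
  by (induction q n k rule: gauss_binomial.induct) auto

lemma gauss_binomial_self [simp]: "gauss_binomial q n n = 1"
  by (induction n) (auto simp: gauss_binomial_eq_0)

text \<open>The q-Pochhammer symbol (q; q)_n; with q^r in place of q its limit is f_r.\<close>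

definition q_fact :: "'a::comm_ring_1 \<Rightarrow> nat \<Rightarrow> 'a" where
  "q_fact q n = (\<Prod>i\<in>{1..n}. 1 - q ^ i)"

lemma q_fact_0 [simp]: "q_fact q 0 = 1"
  by (simp add: q_fact_def)

lemma q_fact_Suc [simp]: "q_fact q (Suc n) = q_fact q n * (1 - q ^ Suc n)"
  by (simp add: q_fact_def)

text \<open>The quotient formula with denominators cleared. Pascal's rule reduces it to 1 - q^(k +
  l) = (1 - q^k) + q^k (1 - q^l).\<close>

lemma gauss_binomial_q_fact:
  "q_fact q k * q_fact q l * gauss_binomial q (k + l) k = q_fact q (k + l)"
proof (induction "k + l" arbitrary: k l)
  case (Suc n)
  show ?case
  proof (cases "k = 0 \<or> l = 0")
    case False
    then obtain k' l' where [simp]: "k = Suc k'" "l = Suc l'" by (meson not0_implies_Suc)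
    have 1: "q_fact q k' * q_fact q l * gauss_binomial q (k' + l) k' = q_fact q n"
      and 2: "q_fact q k * q_fact q l' * gauss_binomial q (k + l') k = q_fact q n"
      using Suc.hyps(1)[of k' l] Suc.hyps(1)[of k l'] Suc.hyps(2) by auto
    have "q_fact q k * q_fact q l * gauss_binomial q (k + l) k =
        (1 - q ^ k) * (q_fact q k' * q_fact q l * gauss_binomial q (k' + l) k') +
        q ^ k * (1 - q ^ l) * (q_fact q k * q_fact q l' * gauss_binomial q (k + l') k)"
      by (simp add: algebra_simps)
    also have "\<dots> = (1 - q ^ (k + l)) * q_fact q n"
      unfolding 1 2 by (simp add: algebra_simps power_add)
    also have "\<dots> = q_fact q (k + l)"
      using Suc.hyps(2) by (metis mult.commute q_fact_Suc)
    finally show ?thesis .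
  qed auto
qed auto

text \<open>The recursion treats \<open>k\<close> and \<open>l\<close> differently, but the product
  formula is symmetric in them; \<open>q\<close> is no root of unity, so the factors
  \<open>q_fact\<close> can be cancelled.\<close>

lemma gauss_binomial_symmetric:
  fixes q :: "'a::idom"
  assumes "\<And>i. i > 0 \<Longrightarrow> q ^ i \<noteq> 1"
  shows "gauss_binomial q (k + l) k = gauss_binomial q (k + l) l"
proof -
  have "q_fact q k * q_fact q l * gauss_binomial q (k + l) k =
        q_fact q k * q_fact q l * gauss_binomial q (k + l) l"
    using gauss_binomial_q_fact[of q k l] gauss_binomial_q_fact[of q l k]
    by (simp add: ac_simps)
  moreover have "q_fact q n \<noteq> 0" for n
    using assms by (auto simp: q_fact_def)
  ultimately show ?thesis by simp
qed

lemma Suc_choose_two: "Suc k choose 2 = k + (k choose 2)"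
  by (simp add: numeral_2_eq_2)

text \<open>Homogeneous in \<open>y\<close> and \<open>z\<close>, so that zeros can be shifted by
  powers of \<open>q\<close> without dividing by \<open>q\<close>. Splitting off the factor
  \<open>i = 0\<close> replaces \<open>z\<close> by \<open>z * q\<close>, hence the induction over
  all \<open>z\<close>.\<close>

theorem q_binomial_theorem:
  "(\<Prod>i<n. y + z * q ^ i) =
   (\<Sum>k\<le>n. q ^ (k choose 2) * gauss_binomial q n k * z ^ k * y ^ (n - k))"
proof (induction n arbitrary: z)
  case (Suc n)
  let ?t = "\<lambda>k. q ^ (k choose 2) * gauss_binomial q n k * (z * q) ^ k"
  have "(\<Prod>i<Suc n. y + z * q ^ i) = (y + z) * (\<Prod>i<n. y + (z * q) * q ^ i)"
    by (subst prod.lessThan_Suc_shift) (simp add: mult.assoc)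
  also have "\<dots> = (y + z) * (\<Sum>k\<le>n. ?t k * y ^ (n - k))"
    unfolding Suc.IH ..
  also have "\<dots> = (\<Sum>k\<le>n. ?t k * y ^ (Suc n - k)) + (\<Sum>k\<le>n. z * ?t k * y ^ (n - k))"
    unfolding distrib_right sum_distrib_left sum.distrib
    by (intro arg_cong2[of _ _ _ _ "(+)"] sum.cong) (auto simp: Suc_diff_le ac_simps)
  also have "(\<Sum>k\<le>n. ?t k * y ^ (Suc n - k)) = (\<Sum>k\<le>Suc n. ?t k * y ^ (Suc n - k))"
    by (simp add: gauss_binomial_eq_0)
  also have "\<dots> = y ^ Suc n + (\<Sum>k\<le>n. ?t (Suc k) * y ^ (n - k))"
    by (subst sum.atMost_Suc_shift) (simp add: binomial_eq_0)
  also have "y ^ Suc n + (\<Sum>k\<le>n. ?t (Suc k) * y ^ (n - k)) + (\<Sum>k\<le>n. z * ?t k * y ^ (n - k)) =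
    y ^ Suc n + (\<Sum>k\<le>n. q ^ (Suc k choose 2) * gauss_binomial q (Suc n) (Suc k) * z ^ Suc k * y ^ (n - k))"
    unfolding add.assoc sum.distrib[symmetric]
    by (intro arg_cong2[of _ _ _ _ "(+)"] refl sum.cong)
       (simp add: Suc_choose_two power_add power_mult_distrib algebra_simps)
  also have "\<dots> = (\<Sum>k\<le>Suc n. q ^ (k choose 2) * gauss_binomial q (Suc n) k * z ^ k * y ^ (Suc n - k))"
    by (subst sum.atMost_Suc_shift) (simp add: binomial_eq_0)
  finally show ?case .
qed (simp add: binomial_eq_0)

text \<open>Lets the q-binomial theorem be used over polynomials in z with \<open>q\<close> as a
  constant, where it can be differentiated.\<close>

lemma gauss_binomial_const_poly: "gauss_binomial [:q:] n k = [:gauss_binomial q n k:]"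
  by (induction q n k rule: gauss_binomial.induct) (auto simp: poly_const_pow one_pCons mult_ac)

lemma sum_split_middle:
  fixes f :: "nat \<Rightarrow> 'a::comm_monoid_add"
  shows "(\<Sum>k\<le>2 * n + 1. f k) = (\<Sum>m\<le>n. f (n - m) + f (n + 1 + m))"
proof -
  have "(\<Sum>k\<le>2 * n + 1. f k) = (\<Sum>k\<le>n. f k) + (\<Sum>k\<in>{Suc n..(n + 1) + n}. f k)"
    using sum_up_index_split[of f n "n + 1"] by (simp add: mult_2)
  also have "(\<Sum>k\<le>n. f k) = (\<Sum>m\<le>n. f (n - m))"
    using sum.nat_diff_reindex[of f "Suc n"] by (simp add: lessThan_Suc_atMost)
  also have "(\<Sum>k\<in>{Suc n..(n + 1) + n}. f k) = (\<Sum>m\<le>n. f (n + 1 + m))"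
    using sum.shift_bounds_cl_nat_ivl[of f 0 "n + 1" n]
    by (simp add: atLeast0AtMost ac_simps)
  finally show ?thesis by (simp add: sum.distrib)
qed

section \<open>The finite form of Jacobi's identity\<close>

lemma pderiv_sum: "pderiv (\<Sum>x\<in>A. f x) = (\<Sum>x\<in>A. pderiv (f x))"
  by (induction A rule: infinite_finite_induct) (simp_all add: pderiv_add)

text \<open>Differentiate the q-binomial theorem at the zero \<open>z = 1\<close> of its left-hand side.\<close>

lemma q_binomial_derivative:
  fixes q :: "'a::idom"
  shows "- (q ^ n) * (\<Prod>i\<in>{..<2 * n + 1} - {n}. q ^ n - q ^ i) =
    (\<Sum>k\<le>2 * n + 1. of_nat k * (- 1) ^ k *
       q ^ ((k choose 2) + n * (2 * n + 1 - k)) * gauss_binomial q (2 * n + 1) k)"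
proof -
  let ?N = "2 * n + 1"
  \<comment> \<open>The choice y = \<open>q ^ n\<close> turns the factor \<open>i = n\<close> into
    q^n (1 - z), which vanishes at z = 1; \<open>R\<close> collects the other factors.\<close>
  define P where "P = (\<Prod>i<?N. [:q ^ n:] + [:0, -1:] * [:q:] ^ i)"
  define R where "R = (\<Prod>i\<in>{..<?N} - {n}. [:q ^ n, - (q ^ i):])"
  have "P = (\<Prod>i<?N. [:q ^ n, - (q ^ i):])"
    unfolding P_def by (simp add: poly_const_pow)
  also have "\<dots> = [:q ^ n, - (q ^ n):] * R"
    unfolding R_def by (rule prod.remove) auto
  finally have "pderiv P = [:q ^ n, - (q ^ n):] * pderiv R + R * pderiv [:q ^ n, - (q ^ n):]"
    by (simp only: pderiv_mult)
  then have "poly (pderiv P) 1 = - (q ^ n) * poly R 1"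
    by (simp add: pderiv_pCons)
  then have 1: "poly (pderiv P) 1 = - (q ^ n) * (\<Prod>i\<in>{..<?N} - {n}. q ^ n - q ^ i)"
    by (simp add: R_def poly_prod)
  have monom: "[:0, -1:] ^ k = monom ((-1) ^ k) k" for k
    by (induction k) (auto simp: monom_Suc one_pCons monom_0 smult_monom)
  have "P = (\<Sum>k\<le>?N. [:q:] ^ (k choose 2) * gauss_binomial [:q:] ?N k * [:0, -1:] ^ k * [:q ^ n:] ^ (?N - k))"
    unfolding P_def by (rule q_binomial_theorem)
  also have "\<dots> = (\<Sum>k\<le>?N. monom (q ^ ((k choose 2) + n * (?N - k)) *
                            gauss_binomial q ?N k * (- 1) ^ k) k)"
    unfolding gauss_binomial_const_poly monom
    by (intro sum.cong refl) (simp add: poly_const_pow smult_monom power_add power_mult ac_simps)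
  finally have "poly (pderiv P) 1 = (\<Sum>k\<le>?N. of_nat k * (- 1) ^ k *
       q ^ ((k choose 2) + n * (?N - k)) * gauss_binomial q ?N k)"
    by (simp add: pderiv_sum poly_sum pderiv_monom poly_monom ac_simps del: sum.atMost_Suc)
  with 1 show ?thesis by simp
qed

lemma choose_two_add: "(k + l) choose 2 = (k choose 2) + (l choose 2) + k * l"
  by (induction l) (auto simp: Suc_choose_two)

lemma double_choose_two: "2 * (k choose 2) + k = k * k"
  by (induction k) (auto simp: Suc_choose_two binomial_eq_0)

lemma prod_power_lessThan: "(\<Prod>i<n. q ^ i) = (q::'a::comm_monoid_mult) ^ (n choose 2)"
  by (induction n) (auto simp: Suc_choose_two power_add ac_simps binomial_eq_0)

lemma q_fact_eq_lessThan: "q_fact q n = (\<Prod>i<n. 1 - q ^ Suc i)"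
  unfolding q_fact_def by (simp add: prod.atLeast1_atMost_eq)

lemma q_fact_eq_lessThan_rev: "q_fact q n = (\<Prod>i<n. 1 - q ^ (n - i))"
  unfolding q_fact_eq_lessThan
  by (subst prod.nat_diff_reindex[symmetric]) (auto intro!: prod.cong simp: Suc_diff_Suc)

text \<open>Both sides of \<open>q_binomial_derivative\<close> are evaluated. The factors below and
  above \<open>n\<close> each give one \<open>q_fact q n\<close>. The terms k = n - m and k = n + 1
  + m agree except for opposite signs and their weights k, so each pair leaves the weight 2 m +
  1.\<close>

theorem finite_jacobi:
  fixes q :: "'a::idom"
  assumes q0: "q \<noteq> 0" and q1: "\<And>i. i > 0 \<Longrightarrow> q ^ i \<noteq> 1"
  shows "q_fact q n ^ 2 =
    (\<Sum>m\<le>n. (- 1) ^ m * of_nat (2 * m + 1) * q ^ (Suc m choose 2) *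
       gauss_binomial q (2 * n + 1) (n - m))"
proof -
  let ?N = "2 * n + 1"
  let ?f = "\<lambda>k. of_nat k * (- 1) ^ k * q ^ ((k choose 2) + n * (?N - k)) * gauss_binomial q ?N k"
  \<comment> \<open>The power of \<open>q\<close> common to both sides: \<open>n\<close> comes from
    the linear factor, \<open>n choose 2\<close> from the factors below \<open>n\<close>, and
    \<open>n * n\<close> from those above.\<close>
  let ?E = "n + (n choose 2) + n * n"
  let ?g = "\<lambda>m. (- 1) ^ m * of_nat (2 * m + 1) * q ^ (Suc m choose 2) * gauss_binomial q ?N (n - m)"
  have low: "(\<Prod>i<n. q ^ n - q ^ i) = (- 1) ^ n * q ^ (n choose 2) * q_fact q n"
  proof -
    have "(\<Prod>i<n. q ^ n - q ^ i) = (\<Prod>i<n. (- 1) * q ^ i * (1 - q ^ (n - i)))"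
      by (intro prod.cong refl) (simp add: algebra_simps flip: power_add)
    then show ?thesis
      by (simp only: prod.distrib prod_constant card_lessThan prod_power_lessThan q_fact_eq_lessThan_rev)
  qed
  have high: "(\<Prod>i\<in>{Suc n..<?N}. q ^ n - q ^ i) = q ^ (n * n) * q_fact q n"
  proof -
    have "(\<Prod>i\<in>{Suc n..<?N}. q ^ n - q ^ i) = (\<Prod>i<n. q ^ n - q ^ (i + Suc n))"
      using prod.shift_bounds_nat_ivl[of "\<lambda>i. q ^ n - q ^ i" 0 "Suc n" n]
      by (simp add: lessThan_atLeast0 mult_2)
    also have "\<dots> = (\<Prod>i<n. q ^ n * (1 - q ^ Suc i))"
      by (intro prod.cong refl) (simp add: algebra_simps power_add)
    finally show ?thesis by (simp add: prod.distrib q_fact_eq_lessThan power_mult)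
  qed
  have "{..<?N} - {n} = {..<n} \<union> {Suc n..<?N}" by auto
  moreover have "(\<Prod>i\<in>{..<n} \<union> {Suc n..<?N}. q ^ n - q ^ i) =
      (\<Prod>i<n. q ^ n - q ^ i) * (\<Prod>i\<in>{Suc n..<?N}. q ^ n - q ^ i)"
    by (rule prod.union_disjoint) auto
  ultimately have "(\<Prod>i\<in>{..<?N} - {n}. q ^ n - q ^ i) =
      (- 1) ^ n * q ^ (n choose 2) * q_fact q n * (q ^ (n * n) * q_fact q n)"
    unfolding low high by (rule trans[OF arg_cong])
  then have "- (q ^ n) * (\<Prod>i\<in>{..<?N} - {n}. q ^ n - q ^ i) =
             - (q ^ ?E * (- 1) ^ n * q_fact q n ^ 2)"
    unfolding power_add power2_eq_square by (simp only: mult_minus_left mult_minus_right ac_simps)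
  then have "- (q ^ ?E * (- 1) ^ n * q_fact q n ^ 2) = (\<Sum>k\<le>?N. ?f k)"
    unfolding q_binomial_derivative by (rule sym)
  also have "\<dots> = (\<Sum>m\<le>n. ?f (n - m) + ?f (n + 1 + m))"
    by (rule sum_split_middle)
  also have "\<dots> = (\<Sum>m\<le>n. - (q ^ ?E * (- 1) ^ n) * ?g m)"
  proof (intro sum.cong refl)
    fix m assume "m \<in> {..n}"
    then obtain l where n: "n = l + m" by (metis atMost_iff le_add_diff_inverse2)
    let ?B = "gauss_binomial q ?N l"
    have nm: "n - m = l" using n by simp
    have e1: "(l choose 2) + n * (?N - l) = ?E + (Suc m choose 2)"
      using double_choose_two[of m] by (simp add: n choose_two_add Suc_choose_two algebra_simps)
    have e2: "((n + 1 + m) choose 2) + n * (?N - (n + 1 + m)) = ?E + (Suc m choose 2)"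
      using double_choose_two[of m] by (simp add: n choose_two_add Suc_choose_two algebra_simps)
    have sym: "gauss_binomial q ?N (n + 1 + m) = ?B"
    proof -
      have "?N = l + (n + 1 + m)" using n by simp
      then show ?thesis
        by (simp only:) (rule gauss_binomial_symmetric[symmetric], rule q1)
    qed
    have s1: "(- 1 :: 'a) ^ n * (- 1) ^ m = (- 1) ^ l"
      by (simp add: n power_add mult.assoc flip: power_mult_distrib)
    have s2: "(- 1 :: 'a) ^ (n + 1 + m) = - ((- 1) ^ l)"
      by (simp add: power_add s1)
    have "?f (n - m) + ?f (n + 1 + m) =
        (of_nat l - of_nat (n + 1 + m)) * (- 1) ^ l * q ^ (?E + (Suc m choose 2)) * ?B"
      unfolding nm sym s2 e2 e1 by (simp only: left_diff_distrib mult_minus_left mult_minus_right) simp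
    also have "\<dots> = - of_nat (2 * m + 1) * (- 1) ^ l * q ^ (?E + (Suc m choose 2)) * ?B"
      by (simp add: n algebra_simps)
    also have "\<dots> = - (q ^ ?E * (- 1) ^ n) * ?g m"
      unfolding s1[symmetric] nm power_add by (simp only: mult_minus_left mult_minus_right ac_simps)
    finally show "?f (n - m) + ?f (n + 1 + m) = - (q ^ ?E * (- 1) ^ n) * ?g m" .
  qed
  finally have "- (q ^ ?E * (- 1) ^ n) * q_fact q n ^ 2 = - (q ^ ?E * (- 1) ^ n) * (\<Sum>m\<le>n. ?g m)"
    by (simp only: sum_distrib_left mult_minus_left)
  moreover have "- (q ^ ?E * (- 1) ^ n) \<noteq> 0" using q0 by simp
  ultimately show ?thesis by (rule iffD1[OF mult_left_cancel, rotated])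
qed

section \<open>The finite form of Gauss' identity\<close>

definition odd_fact :: "'a::comm_ring_1 \<Rightarrow> nat \<Rightarrow> 'a" where
  "odd_fact q n = (\<Prod>i<n. 1 - q ^ (2 * i + 1))"

text \<open>Separates the factors of (q; q)_(2 n) by parity. In the limit \<open>odd_fact\<close>
  becomes f_1 / f_2, so its square times f_2 is f_1^2 / f_2.\<close>

lemma odd_fact_mult_q_fact: "odd_fact q n * q_fact (q ^ 2) n = q_fact q (2 * n)"
proof (induction n)
  case (Suc n)
  have "(q ^ 2) ^ Suc n = q ^ Suc (2 * n + 1)"
    unfolding power_mult[symmetric] by (rule arg_cong[where f = "power q"]) simp
  then have "odd_fact q (Suc n) * q_fact (q ^ 2) (Suc n) =
    odd_fact q n * q_fact (q ^ 2) n * (1 - q ^ (2 * n + 1)) * (1 - q ^ Suc (2 * n + 1))"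
    by (simp only: odd_fact_def prod.lessThan_Suc q_fact_Suc ac_simps)
  also have "\<dots> = q_fact q (2 * Suc n)"
    unfolding Suc.IH by simp
  finally show ?case .
qed (simp add: odd_fact_def)

lemma odd_fact_rev: "odd_fact q n = (\<Prod>i<n. 1 - q ^ (2 * (n - i) - 1))"
  unfolding odd_fact_def
  by (subst prod.nat_diff_reindex[symmetric]) (auto intro!: prod.cong arg_cong[of _ _ "power q"])

lemma prod_odd_power: "(\<Prod>i<n. q ^ (2 * i + 1)) = (q::'a::comm_monoid_mult) ^ (n * n)"
  by (induction n) (auto simp: power_add mult_2_right ac_simps)

text \<open>The q-binomial theorem with base q^2, 2 n factors, y = q^(2 n) and z = -q. Each half of
  the factors gives one \<open>odd_fact q n\<close>, and completing the square centres the exponents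
  at k = n.\<close>

theorem finite_gauss:
  fixes q :: "'a::idom"
  assumes q0: "q \<noteq> 0"
  shows "odd_fact q n ^ 2 =
    (\<Sum>k\<le>2 * n. (- 1) ^ (n + k) * q ^ (nat \<bar>int n - int k\<bar> ^ 2) * gauss_binomial (q ^ 2) (2 * n) k)"
    (is "_ = (\<Sum>k\<le>2 * n. ?g k)")
proof -
  let ?N = "2 * n"
  let ?F = "\<lambda>i. q ^ (2 * n) + (- q) * (q ^ 2) ^ i"
  have F: "?F i = q ^ (2 * n) - q ^ (2 * i + 1)" for i
    by (simp flip: power_mult)
  have low: "(\<Prod>i<n. ?F i) = (- 1) ^ n * q ^ (n * n) * odd_fact q n"
  proof -
    have "(\<Prod>i<n. ?F i) = (\<Prod>i<n. (- 1) * q ^ (2 * i + 1) * (1 - q ^ (2 * (n - i) - 1)))"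
    proof (intro prod.cong refl)
      fix i assume "i \<in> {..<n}"
      then have "2 * n = (2 * i + 1) + (2 * (n - i) - 1)" by auto
      then have "q ^ (2 * n) = q ^ (2 * i + 1) * q ^ (2 * (n - i) - 1)"
        by (metis power_add)
      then show "?F i = (- 1) * q ^ (2 * i + 1) * (1 - q ^ (2 * (n - i) - 1))"
        unfolding F by (simp add: algebra_simps)
    qed
    then show ?thesis
      by (simp only: prod.distrib prod_constant card_lessThan prod_odd_power odd_fact_rev)
  qed
  have high: "(\<Prod>i\<in>{n..<?N}. ?F i) = q ^ (2 * n * n) * odd_fact q n"
  proof -
    have "(\<Prod>i\<in>{n..<?N}. ?F i) = (\<Prod>i<n. ?F (i + n))"
      using prod.shift_bounds_nat_ivl[of ?F 0 n n] by (simp add: lessThan_atLeast0 mult_2)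
    also have "\<dots> = (\<Prod>i<n. q ^ (2 * n) * (1 - q ^ (2 * i + 1)))"
      unfolding F by (intro prod.cong refl) (simp add: algebra_simps power_add)
    finally show ?thesis by (simp only: prod.distrib prod_constant card_lessThan odd_fact_def power_mult)
  qed
  have "q ^ (3 * n * n) * (- 1) ^ n * odd_fact q n ^ 2 = (\<Prod>i<n. ?F i) * (\<Prod>i\<in>{n..<?N}. ?F i)"
  proof -
    have "3 * n * n = n * n + 2 * n * n" by simp
    then show ?thesis
      unfolding low high power2_eq_square[of "odd_fact q n"] by (simp only: power_add ac_simps)
  qed
  also have "\<dots> = (\<Prod>i<?N. ?F i)"
    unfolding lessThan_atLeast0 by (rule prod.atLeastLessThan_concat) auto
  also have "\<dots> = (\<Sum>k\<le>?N. (q ^ 2) ^ (k choose 2) * gauss_binomial (q ^ 2) ?N k *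
                          (- q) ^ k * (q ^ (2 * n)) ^ (?N - k))"
    by (rule q_binomial_theorem)
  also have "\<dots> = (\<Sum>k\<le>?N. q ^ (3 * n * n) * (- 1) ^ n * ?g k)"
  proof (intro sum.cong refl)
    fix k assume "k \<in> {..?N}"
    then obtain l where l: "?N = k + l" by (metis atMost_iff le_add_diff_inverse)
    let ?a = "nat \<bar>int n - int k\<bar>"
    \<comment> \<open>Since l = 2 n - k, the left side is k^2 + 2 n (2 n - k) = 3 n^2 + (n - k)^2;
      over \<open>int\<close> the differences are genuine.\<close>
    have "int (2 * (k choose 2) + k + 2 * n * l) = int (3 * n * n + ?a ^ 2)"
    proof -
      have l': "int l = 2 * int n - int k" using l by linarith
      have "int (2 * (k choose 2) + k + 2 * n * l) = int k * int k + 2 * int n * int l"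
        unfolding double_choose_two by simp
      also have "\<dots> = 3 * int n * int n + (int n - int k) ^ 2"
        unfolding l' by (simp add: power2_eq_square algebra_simps)
      finally show ?thesis by simp
    qed
    then have e: "2 * (k choose 2) + k + 2 * n * l = 3 * n * n + ?a ^ 2"
      by (simp only: of_nat_eq_iff)
    have "(q ^ 2) ^ (k choose 2) * gauss_binomial (q ^ 2) ?N k * (- q) ^ k * (q ^ (2 * n)) ^ (?N - k) =
          (- 1) ^ k * q ^ (2 * (k choose 2) + k + 2 * n * l) * gauss_binomial (q ^ 2) ?N k"
    proof -
      have "?N - k = l" using l by simp
      then show ?thesis
        by (simp only: power_minus[of q] power_add power_mult[symmetric] ac_simps)
    qed
    also have "\<dots> = q ^ (3 * n * n) * (- 1) ^ n * ?g k"
      unfolding e by (simp add: power_add ac_simps flip: power_mult_distrib)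
    finally show "(q ^ 2) ^ (k choose 2) * gauss_binomial (q ^ 2) ?N k * (- q) ^ k * (q ^ (2 * n)) ^ (?N - k)
       = q ^ (3 * n * n) * (- 1) ^ n * ?g k" .
  qed
  finally have "q ^ (3 * n * n) * (- 1) ^ n * odd_fact q n ^ 2 =
                q ^ (3 * n * n) * (- 1) ^ n * (\<Sum>k\<le>?N. ?g k)"
    by (simp only: sum_distrib_left)
  moreover have "q ^ (3 * n * n) * (- 1) ^ n \<noteq> 0" using q0 by simp
  ultimately show ?thesis by (rule iffD1[OF mult_left_cancel, rotated])
qed

subsection \<open>Euler products over the integers\<close>

text \<open>f_r over the integers, with the diagonal truncation of \<open>qpoch_f\<close>: over the
  rationals divisibility by 9 would say nothing.\<close>

definition euler :: "nat \<Rightarrow> int fps" where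
  "euler r = Abs_fps (\<lambda>n. fps_nth (q_fact (fps_X ^ r) n) n)"

lemma dvd_cong_fps_X_power_nth:
  fixes F G :: "'a::comm_ring_1 fps"
  assumes "dvd_cong (fps_X ^ k) F G" "n < k"
  shows "F $ n = G $ n"
proof -
  obtain H where "F - G = fps_X ^ k * H"
    using assms(1) unfolding dvd_cong_def by (elim dvdE)
  then have "(F - G) $ n = 0"
    using assms(2) by (simp add: fps_X_power_mult_nth)
  then show ?thesis by simp
qed

lemma dvd_cong_fps_X_powerI:
  fixes F G :: "'a::comm_ring_1 fps"
  assumes "\<And>n. n < k \<Longrightarrow> F $ n = G $ n"
  shows "dvd_cong (fps_X ^ k) F G"
proof -
  have "F - G = fps_X ^ k * fps_shift k (F - G)"
    using assms by (intro fps_ext) (simp add: fps_X_power_mult_nth)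
  then show ?thesis unfolding dvd_cong_def by (metis dvd_triv_left)
qed

text \<open>A factor with index i > k is 1 modulo \<open>fps_X ^ (r * i)\<close>, and r i >
  k.\<close>

lemma q_fact_stable:
  assumes "r > 0" "k \<le> n"
  shows "dvd_cong (fps_X ^ Suc k) (q_fact (fps_X ^ r) n) (q_fact (fps_X ^ r) k :: int fps)"
  using assms(2)
proof (induction n rule: dec_induct)
  case (step n)
  have "Suc k \<le> r * Suc n" using assms(1) step.hyps
    by (metis Suc_le_mono le_trans mult_le_mono1 nat_mult_1 One_nat_def Suc_leI)
  then have "fps_X ^ Suc k dvd (fps_X ^ r) ^ Suc n * (- q_fact (fps_X ^ r) n :: int fps)"
    unfolding power_mult[symmetric] by (intro dvd_mult2 le_imp_power_dvd)
  then have "dvd_cong (fps_X ^ Suc k) (q_fact (fps_X ^ r) (Suc n)) (q_fact (fps_X ^ r) n :: int fps)"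
    unfolding dvd_cong_def by (simp add: algebra_simps)
  then show ?case using step.IH by (rule dvd_cong_trans)
qed simp

text \<open>\<open>euler\<close> reads each coefficient off a different partial product; by
  stability, a single partial product gives all coefficients up to \<open>n\<close>.\<close>

lemma euler_cong:
  assumes "r > 0"
  shows "dvd_cong (fps_X ^ Suc n) (euler r) (q_fact (fps_X ^ r) n)"
proof (rule dvd_cong_fps_X_powerI)
  fix k assume "k < Suc n"
  then show "euler r $ k = q_fact (fps_X ^ r) n $ k"
    unfolding euler_def
    using dvd_cong_fps_X_power_nth[OF q_fact_stable[OF assms, of k n], of k] by simp
qed

lemma euler_nth_0: "euler r $ 0 = 1"
  by (simp add: euler_def)

lemma unit_fps_int:
  fixes F :: "int fps"
  assumes "F $ 0 = 1"
  obtains U where "F * U = 1"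
  using fps_right_inverse[of F 1] assms by auto

section \<open>Limits of the finite identities\<close>

lemma fps_X_power_neq_1: "r > 0 \<Longrightarrow> i > 0 \<Longrightarrow> (fps_X ^ r) ^ i \<noteq> (1 :: int fps)"
  unfolding power_mult[symmetric] by (auto simp: fps_eq_iff intro!: exI[of _ 0])

text \<open>Far from both ends a Gaussian binomial is close to 1 / f_r: in the product formula all
  three \<open>q_fact\<close> agree with \<open>euler r\<close> to order \<open>n\<close>, and one
  \<open>euler r\<close> cancels against its inverse \<open>U\<close>.\<close>

lemma euler_mult_gauss_binomial:
  assumes r: "r > 0" and k: "n \<le> k" and l: "n \<le> l"
  shows "dvd_cong (fps_X ^ Suc n) (euler r * gauss_binomial (fps_X ^ r) (k + l) k) 1"
proof -
  let ?q = "fps_X ^ r :: int fps"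
  obtain U where U: "euler r * U = 1"
    using unit_fps_int[OF euler_nth_0] by blast
  have c: "dvd_cong (fps_X ^ Suc n) (euler r) (q_fact ?q m)" if "n \<le> m" for m
    using dvd_cong_trans[OF euler_cong[OF r] dvd_cong_sym[OF q_fact_stable[OF r that]]] .
  have "dvd_cong (fps_X ^ Suc n) (euler r * euler r * gauss_binomial ?q (k + l) k)
          (q_fact ?q k * q_fact ?q l * gauss_binomial ?q (k + l) k)"
    using k l by (intro dvd_cong_mult c dvd_cong_refl)
  also have "q_fact ?q k * q_fact ?q l * gauss_binomial ?q (k + l) k = q_fact ?q (k + l)"
    by (rule gauss_binomial_q_fact)
  also have "dvd_cong (fps_X ^ Suc n) \<dots> (euler r)"
    using k by (intro dvd_cong_sym[OF c]) simp
  finally have "dvd_cong (fps_X ^ Suc n)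
      (euler r * euler r * gauss_binomial ?q (k + l) k * U) (euler r * U)"
    by (intro dvd_cong_mult dvd_cong_refl)
  also have "euler r * euler r * gauss_binomial ?q (k + l) k * U =
             (euler r * U) * (euler r * gauss_binomial ?q (k + l) k)"
    by (simp only: ac_simps)
  finally show ?thesis unfolding U by simp
qed

text \<open>A factor \<open>fps_X ^ i\<close> improves the precision by \<open>i\<close>. This
  compensates for Gaussian binomials near the ends of the range, which are controlled only to low
  order.\<close>

lemma dvd_cong_fps_X_mult:
  assumes "dvd_cong (fps_X ^ j) F G" and "m \<le> i + j"
  shows "dvd_cong (fps_X ^ m) (c * fps_X ^ i * F) (c * fps_X ^ i * G :: int fps)"
proof -
  have "fps_X ^ (i + j) dvd fps_X ^ i * (F - G)"
    using assms(1) unfolding dvd_cong_def power_add by (intro mult_dvd_mono dvd_refl)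
  then have "fps_X ^ m dvd c * (fps_X ^ i * (F - G))"
    using assms(2) by (meson dvd_mult dvd_trans le_imp_power_dvd)
  then show ?thesis unfolding dvd_cong_def by (simp add: algebra_simps)
qed

text \<open>The finite form times one more \<open>euler r\<close>. The term \<open>m\<close> loses
  \<open>m\<close> orders of precision, which its power of \<open>fps_X\<close> restores, since r m
  (m + 1) / 2 >= m.\<close>

theorem jacobi_identity:
  assumes r: "r > 0"
  shows "dvd_cong (fps_X ^ Suc n) (euler r ^ 3)
    (\<Sum>m\<le>n. (- 1) ^ m * of_nat (2 * m + 1) * fps_X ^ (r * (Suc m choose 2)))"
proof -
  let ?q = "fps_X ^ r :: int fps"
  have "dvd_cong (fps_X ^ Suc n) (euler r ^ 3) (euler r * q_fact ?q n ^ 2)"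
    unfolding power3_eq_cube mult.assoc power2_eq_square
    by (intro dvd_cong_mult dvd_cong_refl euler_cong r)
  also have "euler r * q_fact ?q n ^ 2 =
      (\<Sum>m\<le>n. (- 1) ^ m * of_nat (2 * m + 1) * fps_X ^ (r * (Suc m choose 2)) *
        (euler r * gauss_binomial ?q (2 * n + 1) (n - m)))"
    by (subst finite_jacobi)
       (auto simp: fps_X_power_neq_1 r sum_distrib_left power_mult ac_simps intro!: sum.cong)
  also have "dvd_cong (fps_X ^ Suc n) \<dots>
      (\<Sum>m\<le>n. (- 1) ^ m * of_nat (2 * m + 1) * fps_X ^ (r * (Suc m choose 2)) * 1)"
  proof (intro dvd_cong_sum dvd_cong_fps_X_mult)
    fix m assume "m \<in> {..n}"
    then have m: "m \<le> n" by simp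
    have "2 * n + 1 = (n - m) + (n + m + 1)" using m by simp
    then show "dvd_cong (fps_X ^ Suc (n - m)) (euler r * gauss_binomial ?q (2 * n + 1) (n - m)) 1"
      by (simp only:) (rule euler_mult_gauss_binomial[OF r], auto)
    have "m \<le> r * (Suc m choose 2)" using r by (cases r) (auto simp: Suc_choose_two)
    then show "Suc n \<le> r * (Suc m choose 2) + Suc (n - m)" using m by linarith
  qed
  finally show ?thesis by simp
qed

text \<open>Squares f_1 = (f_1 / f_2) f_2 with \<open>odd_fact\<close> in place of the quotient. The
  theta series runs over x = n - k, and f_2 stays on the right to avoid a division.\<close>

theorem gauss_identity:
  "dvd_cong (fps_X ^ Suc n) (euler 1 ^ 2)
    (euler 2 * (\<Sum>k\<le>2 * n. (- 1) ^ (n + k) * fps_X ^ (nat \<bar>int n - int k\<bar> ^ 2)))"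
proof -
  let ?q = "fps_X :: int fps"
  have "dvd_cong (fps_X ^ Suc n) (euler 1) (q_fact ?q (2 * n))"
    using dvd_cong_trans[OF euler_cong[of 1 n] dvd_cong_sym[OF q_fact_stable[of 1 n "2 * n"]]] by simp
  also have "q_fact ?q (2 * n) = odd_fact ?q n * q_fact (?q ^ 2) n"
    by (rule odd_fact_mult_q_fact[symmetric])
  also have "dvd_cong (fps_X ^ Suc n) \<dots> (odd_fact ?q n * euler 2)"
    by (intro dvd_cong_mult dvd_cong_refl dvd_cong_sym[OF euler_cong]) simp
  finally have "dvd_cong (fps_X ^ Suc n) (euler 1 ^ 2) ((odd_fact ?q n * euler 2) ^ 2)"
    by (rule dvd_cong_power)
  also have "(odd_fact ?q n * euler 2) ^ 2 = euler 2 * (euler 2 * odd_fact ?q n ^ 2)"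
    by (simp add: power2_eq_square ac_simps)
  also have "euler 2 * odd_fact ?q n ^ 2 =
      (\<Sum>k\<le>2 * n. (- 1) ^ (n + k) * fps_X ^ (nat \<bar>int n - int k\<bar> ^ 2) *
        (euler 2 * gauss_binomial (?q ^ 2) (2 * n) k))"
    by (subst finite_gauss) (auto simp: sum_distrib_left ac_simps intro!: sum.cong)
  also have "dvd_cong (fps_X ^ Suc n) (euler 2 * \<dots>)
      (euler 2 * (\<Sum>k\<le>2 * n. (- 1) ^ (n + k) * fps_X ^ (nat \<bar>int n - int k\<bar> ^ 2) * 1))"
  proof (rule dvd_cong_mult[OF dvd_cong_refl], intro dvd_cong_sum dvd_cong_fps_X_mult)
    fix k assume "k \<in> {..2 * n}"
    then obtain l where kl: "2 * n = k + l" by (metis atMost_iff le_add_diff_inverse)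
    let ?a = "nat \<bar>int n - int k\<bar>"
    have a: "?a \<le> n" "n - ?a \<le> k" "n - ?a \<le> l" using kl by linarith+
    show "dvd_cong (fps_X ^ Suc (n - ?a)) (euler 2 * gauss_binomial (?q ^ 2) (2 * n) k) 1"
      unfolding kl using a by (intro euler_mult_gauss_binomial) auto
    have "?a \<le> ?a ^ 2" unfolding power2_eq_square by (rule le_square)
    then show "Suc n \<le> ?a ^ 2 + Suc (n - ?a)" using a by linarith
  qed
  finally show ?thesis by simp
qed

subsection \<open>The coefficients of \<open>f\<^sub>1\<^sup>2 f\<^sub>2\<^sup>2\<close>\<close>

text \<open>Write f_1^2 f_2^2 as (f_1^2 / f_2) f_2^3 and multiply the two expansions, truncated at
  order \<open>N\<close>; the square is that of x = N - k.\<close>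

lemma euler_1_2_square_nth:
  "(euler 1 ^ 2 * euler 2 ^ 2) $ N =
    (\<Sum>k\<le>2 * N. \<Sum>m\<le>N. (- 1) ^ (N + k + m) * (2 * int m + 1) *
       (if N = nat \<bar>int N - int k\<bar> ^ 2 + m * Suc m then 1 else 0))"
proof -
  let ?a = "\<lambda>k. nat \<bar>int N - int k\<bar> ^ 2"
  let ?G = "\<Sum>k\<le>2 * N. (- 1) ^ (N + k) * fps_X ^ ?a k :: int fps"
  let ?J = "\<Sum>m\<le>N. (- 1) ^ m * of_nat (2 * m + 1) * fps_X ^ (2 * (Suc m choose 2)) :: int fps"
  have "dvd_cong (fps_X ^ Suc N) (euler 1 ^ 2 * euler 2 ^ 2) (euler 2 * ?G * euler 2 ^ 2)"
    by (intro dvd_cong_mult gauss_identity dvd_cong_refl)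
  also have "euler 2 * ?G * euler 2 ^ 2 = ?G * euler 2 ^ 3"
    by (simp only: power2_eq_square power3_eq_cube ac_simps)
  also have "dvd_cong (fps_X ^ Suc N) \<dots> (?G * ?J)"
    by (intro dvd_cong_mult[OF dvd_cong_refl] jacobi_identity) simp
  also have "?G * ?J = (\<Sum>k\<le>2 * N. \<Sum>m\<le>N.
      of_int ((- 1) ^ (N + k + m) * (2 * int m + 1)) * fps_X ^ (?a k + m * Suc m))"
    unfolding sum_product
  proof (intro sum.cong refl)
    fix k m
    have 1: "(of_int ((- 1) ^ (N + k + m) * (2 * int m + 1)) :: int fps) =
        (- 1) ^ (N + k) * (- 1) ^ m * of_nat (2 * m + 1)"
      by (simp add: power_add)
    have 2: "2 * (Suc m choose 2) = m * Suc m"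
      using double_choose_two[of m] by (simp add: Suc_choose_two)
    show "(- 1) ^ (N + k) * (fps_X :: int fps) ^ ?a k *
        ((- 1) ^ m * of_nat (2 * m + 1) * fps_X ^ (2 * (Suc m choose 2))) =
        of_int ((- 1) ^ (N + k + m) * (2 * int m + 1)) * fps_X ^ (?a k + m * Suc m)"
      unfolding 1 2 by (simp only: power_add ac_simps)
  qed
  finally have "(euler 1 ^ 2 * euler 2 ^ 2) $ N = (\<Sum>k\<le>2 * N. \<Sum>m\<le>N.
      of_int ((- 1) ^ (N + k + m) * (2 * int m + 1)) * fps_X ^ (?a k + m * Suc m)) $ N"
    by (rule dvd_cong_fps_X_power_nth) simp
  then show ?thesis
    unfolding fps_sum_nth fps_mult_of_int_nth fps_X_power_nth of_int_eq_id id_apply .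
qed

text \<open>Modulo 3, a square is 0 or 1 and \<open>m * Suc m\<close> is 0, or 2 when m = 1; the sum
  2 thus forces a = 0 and m = 1. Then a = 3 s and m = 3 t + 1 give 2 + 9 (s^2 + t^2 + t).\<close>

lemma square_add_pronic_mod_3:
  fixes a m :: nat
  assumes "(a ^ 2 + m * Suc m) mod 3 = 2"
  shows "m mod 3 = 1" and "(a ^ 2 + m * Suc m) mod 9 = 2"
proof -
  have am: "a mod 3 = 0 \<and> m mod 3 = 1"
  proof -
    have "(a ^ 2 + m * Suc m) mod 3 = ((a mod 3) ^ 2 + (m mod 3) * Suc (m mod 3)) mod 3"
    proof (rule mod_add_cong)
      show "m * Suc m mod 3 = (m mod 3) * Suc (m mod 3) mod 3"
        by (rule mod_mult_cong) (simp_all add: mod_Suc_eq)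
    qed (simp add: power_mod)
    moreover have "a mod 3 \<in> {0, 1, 2}" "m mod 3 \<in> {0, 1, 2}" by auto
    ultimately show ?thesis using assms by auto
  qed
  then show "m mod 3 = 1" ..
  define s t where "s = a div 3" and "t = m div 3"
  have "a = 3 * s" "m = 3 * t + 1"
    using am unfolding s_def t_def by presburger+
  then have "a ^ 2 + m * Suc m = 2 + 9 * (s ^ 2 + t ^ 2 + t)"
    by (simp add: power2_eq_square algebra_simps)
  then show "(a ^ 2 + m * Suc m) mod 9 = 2" by (simp only: mod_mult_self2) simp
qed

lemma euler_1_2_square_nth_dvd_3:
  assumes "N mod 3 = 2"
  shows "3 dvd (euler 1 ^ 2 * euler 2 ^ 2) $ N"
  unfolding euler_1_2_square_nth
proof (intro dvd_sum)
  fix k m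
  show "3 dvd (- 1) ^ (N + k + m) * (2 * int m + 1) *
       (if N = nat \<bar>int N - int k\<bar> ^ 2 + m * Suc m then 1 else 0)"
  proof (cases "N = nat \<bar>int N - int k\<bar> ^ 2 + m * Suc m")
    case True
    then have "m mod 3 = 1" using square_add_pronic_mod_3(1) assms by metis
    then have "3 dvd 2 * int m + 1" by presburger
    then show ?thesis by simp
  qed simp
qed

lemma euler_1_2_square_nth_eq_0:
  assumes "N mod 3 = 2" "N mod 9 \<noteq> 2"
  shows "(euler 1 ^ 2 * euler 2 ^ 2) $ N = 0"
proof -
  have "N \<noteq> nat \<bar>int N - int k\<bar> ^ 2 + m * Suc m" for k m
    using square_add_pronic_mod_3(2) assms by metis
  then show ?thesis unfolding euler_1_2_square_nth by (simp only: if_False mult_zero_right sum.neutral_const)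
qed

subsection \<open>Power series supported on multiples\<close>

definition supported_on_multiples :: "nat \<Rightarrow> 'a::zero fps \<Rightarrow> bool" where
  "supported_on_multiples m F \<longleftrightarrow> (\<forall>n. \<not> m dvd n \<longrightarrow> F $ n = 0)"

lemma supported_on_multiples_1: "supported_on_multiples m (1 :: 'a::comm_ring_1 fps)"
  by (auto simp: supported_on_multiples_def)

lemma supported_on_multiples_mult:
  fixes F G :: "'a::comm_ring_1 fps"
  assumes "supported_on_multiples m F" "supported_on_multiples m G"
  shows "supported_on_multiples m (F * G)"
  unfolding supported_on_multiples_def
proof (intro allI impI)
  fix n assume n: "\<not> m dvd n"
  have "F $ i * G $ (n - i) = 0" if "i \<le> n" for i
  proof (cases "m dvd i")
    case True
    then have "\<not> m dvd n - i" using n that by (metis dvd_diffD)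
    then show ?thesis using assms(2) by (simp add: supported_on_multiples_def)
  qed (use assms(1) in \<open>simp add: supported_on_multiples_def\<close>)
  then show "(F * G) $ n = 0" by (simp add: fps_mult_nth)
qed

lemma supported_on_multiples_power:
  fixes F :: "'a::comm_ring_1 fps"
  shows "supported_on_multiples m F \<Longrightarrow> supported_on_multiples m (F ^ n)"
  by (induction n) (auto intro: supported_on_multiples_1 supported_on_multiples_mult)

text \<open>Strong induction on the coefficient \<open>n\<close> of F U = 1: for i > 0 either
  \<open>m\<close> does not divide i and \<open>F $ i\<close> is 0, or \<open>m\<close> does not
  divide n - i and the induction hypothesis applies.\<close>

lemma supported_on_multiples_inverse:
  fixes F U :: "'a::comm_ring_1 fps"
  assumes F: "supported_on_multiples m F" and FU: "F * U = 1" and F0: "F $ 0 = 1"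
  shows "supported_on_multiples m U"
  unfolding supported_on_multiples_def
proof (intro allI impI)
  fix n assume "\<not> m dvd n"
  then show "U $ n = 0"
  proof (induction n rule: less_induct)
    case (less n)
    have rest: "F $ i * U $ (n - i) = 0" if "i \<in> {Suc 0..n}" for i
    proof (cases "m dvd i")
      case True
      then have "\<not> m dvd n - i" using less.prems that by (metis atLeastAtMost_iff dvd_diffD)
      then show ?thesis using less.IH[of "n - i"] that by simp
    qed (use F in \<open>simp add: supported_on_multiples_def\<close>)
    have "n \<noteq> 0" using less.prems by (metis dvd_0_right)
    then have "0 = (F * U) $ n" unfolding FU by simp
    also have "\<dots> = F $ 0 * U $ n + (\<Sum>i=Suc 0..n. F $ i * U $ (n - i))"
      unfolding fps_mult_nth by (simp add: sum.atLeast_Suc_atMost)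
    also have "(\<Sum>i=Suc 0..n. F $ i * U $ (n - i)) = 0"
      using rest by (rule sum.neutral[rule_format])
    finally show ?case by (simp add: F0)
  qed
qed

lemma supported_on_multiples_euler:
  assumes "m dvd r"
  shows "supported_on_multiples m (euler r)"
proof -
  have "supported_on_multiples m (1 - (fps_X ^ r) ^ i :: int fps)" for i
    using assms unfolding power_mult[symmetric]
    by (auto simp: supported_on_multiples_def)
  then have "supported_on_multiples m (q_fact (fps_X ^ r) n :: int fps)" for n
    by (induction n) (auto intro: supported_on_multiples_1 supported_on_multiples_mult simp del: power_Suc)
  then show ?thesis by (simp add: euler_def supported_on_multiples_def)
qed

subsection \<open>Reduction modulo 3 and 9\<close>

lemma fps_numeral_mult_nth [simp]: "(numeral c * F :: int fps) $ n = numeral c * F $ n"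
  by (simp add: numeral_fps_const)

lemma numeral_dvd_fps:
  fixes F :: "int fps"
  assumes "\<And>n. numeral c dvd F $ n"
  shows "numeral c dvd F"
proof -
  have "F = numeral c * Abs_fps (\<lambda>n. F $ n div numeral c)"
    using assms by (intro fps_ext) simp
  then show ?thesis by (metis dvd_triv_left)
qed

text \<open>Factor by factor, (1 - x)^3 = 1 - x^3 + 3 (x^2 - x).\<close>

lemma q_fact_cube_cong: "dvd_cong 3 (q_fact q n ^ 3) (q_fact (q ^ 3) n)"
proof -
  have "dvd_cong 3 ((1 - q ^ i) ^ 3) (1 - (q ^ 3) ^ i)" for i
  proof -
    have "(1 - x) ^ 3 - (1 - x ^ 3) = 3 * (x ^ 2 - x)" for x :: 'a
      by (simp add: power2_eq_square power3_eq_cube algebra_simps)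
    then have "(1 - q ^ i) ^ 3 - (1 - (q ^ i) ^ 3) = 3 * ((q ^ i) ^ 2 - q ^ i)" .
    moreover have "(q ^ i) ^ 3 = (q ^ 3) ^ i"
      by (simp flip: power_mult add: mult.commute)
    ultimately show ?thesis unfolding dvd_cong_def by simp
  qed
  then show ?thesis
    unfolding q_fact_def prod_power_distrib by (intro dvd_cong_prod)
qed

lemma euler_cube_cong:
  assumes r: "r > 0"
  shows "dvd_cong 3 (euler r ^ 3) (euler (3 * r))"
  unfolding dvd_cong_def
proof (rule numeral_dvd_fps)
  fix n
  have "(fps_X ^ r) ^ 3 = (fps_X ^ (3 * r) :: int fps)"
    by (simp add: mult.commute flip: power_mult)
  then obtain H where H: "q_fact (fps_X ^ r) n ^ 3 - q_fact (fps_X ^ (3 * r)) n = 3 * (H :: int fps)"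
    using q_fact_cube_cong[of "fps_X ^ r :: int fps" n] unfolding dvd_cong_def by (auto elim!: dvdE)
  have "(q_fact (fps_X ^ r) n ^ 3 - q_fact (fps_X ^ (3 * r)) n) $ n = 3 * H $ n"
    unfolding H by simp
  moreover have "(euler r ^ 3) $ n = (q_fact (fps_X ^ r) n ^ 3) $ n"
    by (intro dvd_cong_fps_X_power_nth[of "Suc n"] dvd_cong_power euler_cong r) simp
  moreover have "euler (3 * r) $ n = q_fact (fps_X ^ (3 * r)) n $ n"
    by (simp add: euler_def)
  ultimately show "3 dvd (euler r ^ 3 - euler (3 * r)) $ n" by simp
qed

lemma dvd_cong_inverse_power_9:
  fixes a b u v :: "'a::comm_ring_1"
  assumes "dvd_cong 3 (a ^ 3) b" "a * u = 1" "b * v = 1"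
  shows "dvd_cong 9 (u ^ 9) (v ^ 3)"
proof -
  have "dvd_cong 9 ((u ^ 3) ^ 3) (v ^ 3)"
    by (rule dvd_cong_cube_3_9[OF dvd_cong_cube_inverse[OF assms]])
  then show ?thesis by (simp flip: power_mult)
qed

text \<open>With u = 1 / f_1 the product is G. Modulo 9 it becomes the series \<open>S\<close> in
  q^3, and modulo 3 \<open>S\<close> becomes the series \<open>W\<close> in q^9;
  \<open>9 * A\<close> and \<open>3 * B\<close> are the two errors.\<close>

lemma cofactor_decomposition:
  assumes u: "euler 1 * u = 1"
  obtains A B W where "(euler 2 ^ 9) ^ j * (u ^ 9) ^ (3 * j + 1) = W + 3 * B + 9 * A"
    and "supported_on_multiples 9 W" and "supported_on_multiples 3 B"
proof -
  obtain v w where v: "euler 3 * v = 1" and w: "euler 9 * w = 1"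
    using unit_fps_int[OF euler_nth_0] by metis
  define G where "G = (euler 2 ^ 9) ^ j * (u ^ 9) ^ (3 * j + 1)"
  define S where "S = (euler 6 ^ 3) ^ j * (v ^ 3) ^ (3 * j + 1)"
  define W where "W = euler 18 ^ j * w ^ (3 * j + 1)"
  have "dvd_cong 9 ((euler 2 ^ 3) ^ 3) (euler 6 ^ 3)"
    using euler_cube_cong[of 2] by (intro dvd_cong_cube_3_9) simp
  then have "dvd_cong 9 (euler 2 ^ 9) (euler 6 ^ 3)" by (simp flip: power_mult)
  moreover have "dvd_cong 9 (u ^ 9) (v ^ 3)"
    using euler_cube_cong[of 1] by (intro dvd_cong_inverse_power_9[OF _ u v]) simp
  ultimately have "dvd_cong 9 G S"
    unfolding G_def S_def by (intro dvd_cong_mult dvd_cong_power)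
  then obtain A where A: "G - S = 9 * A" unfolding dvd_cong_def by (elim dvdE)
  have "dvd_cong 3 (euler 6 ^ 3) (euler 18)"
    using euler_cube_cong[of 6] by simp
  moreover have "dvd_cong 3 (v ^ 3) w"
    using euler_cube_cong[of 3] by (intro dvd_cong_cube_inverse[OF _ v w]) simp
  ultimately have "dvd_cong 3 S W"
    unfolding S_def W_def by (intro dvd_cong_mult dvd_cong_power)
  then obtain B where B: "S - W = 3 * B" unfolding dvd_cong_def by (elim dvdE)
  have supp_v: "supported_on_multiples 3 v"
    using supported_on_multiples_inverse[OF supported_on_multiples_euler[OF dvd_refl] v euler_nth_0] .
  have supp_w: "supported_on_multiples m w" if "m dvd 9" for m
    using supported_on_multiples_inverse[OF supported_on_multiples_euler[OF that] w euler_nth_0] .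
  have W: "supported_on_multiples m W" if "m dvd 9" for m
  proof -
    have "m dvd 18" using dvd_mult[OF that, of 2] by simp
    then show ?thesis
      unfolding W_def using that
      by (intro supported_on_multiples_mult supported_on_multiples_power
          supported_on_multiples_euler supp_w)
  qed
  have S: "supported_on_multiples 3 S"
    unfolding S_def
    by (intro supported_on_multiples_mult supported_on_multiples_power
        supported_on_multiples_euler supp_v) simp
  \<comment> \<open>\<open>3 * B\<close> is the difference of two series in q^3, and the factor 3
    cancels over the integers.\<close>
  have "supported_on_multiples 3 B"
    unfolding supported_on_multiples_def
  proof (intro allI impI)
    fix n :: nat assume n: "\<not> 3 dvd n"
    have "3 * B $ n = (S - W) $ n" unfolding B by simp
    also have "\<dots> = 0"
      using n S W[of 3] by (simp add: supported_on_multiples_def)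
    finally show "B $ n = 0" by simp
  qed
  moreover have "G = W + 3 * B + 9 * A"
    unfolding A[symmetric] B[symmetric] by simp
  ultimately show ?thesis using that W[of 9] unfolding G_def by simp
qed

text \<open>Convolve C with each part of the cofactor. \<open>W\<close> shifts indices by multiples
  of 9 and meets only vanishing coefficients of C; \<open>B\<close> shifts them by multiples of 3
  and meets coefficients divisible by 3, which with the factor 3 gives 9.\<close>

lemma int_coefficients_dvd_9:
  assumes u: "euler 1 * u = 1" and N: "N mod 3 = 2" "N mod 9 \<noteq> 2"
  shows "9 dvd (euler 2 ^ (9 * j + 2) * u ^ (3 * (9 * j + 2) + 1)) $ N"
proof -
  let ?C = "euler 1 ^ 2 * euler 2 ^ 2"
  obtain A B W where ABW: "(euler 2 ^ 9) ^ j * (u ^ 9) ^ (3 * j + 1) = W + 3 * B + 9 * A"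
    and W: "supported_on_multiples 9 W" and B: "supported_on_multiples 3 B"
    using cofactor_decomposition[OF u] by metis
  \<comment> \<open>Inserting (f_1 u)^2 = 1 supplies the f_1^2 of C and raises the exponent of u to
    27 j + 9, a multiple of 9.\<close>
  have "euler 2 ^ (9 * j + 2) * u ^ (3 * (9 * j + 2) + 1) =
        (euler 1 * u) ^ 2 * (euler 2 ^ (9 * j + 2) * u ^ (3 * (9 * j + 2) + 1))"
    unfolding u by simp
  also have "\<dots> = ?C * ((euler 2 ^ 9) ^ j * (u ^ 9) ^ (3 * j + 1))"
  proof -
    have e: "9 * (3 * j + 1) = 3 * (9 * j + 2) + 1 + 2" by simp
    show ?thesis
      unfolding power_mult[symmetric] e by (simp only: power_add power_mult_distrib ac_simps)
  qed
  also have "\<dots> = ?C * W + 3 * (?C * B) + 9 * (?C * A)"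
    unfolding ABW distrib_left mult.left_commute[of ?C] ..
  finally have eq: "(euler 2 ^ (9 * j + 2) * u ^ (3 * (9 * j + 2) + 1)) $ N =
      (?C * W) $ N + 3 * (?C * B) $ N + 9 * (?C * A) $ N"
    by (simp only: fps_add_nth fps_numeral_mult_nth)
  have "?C $ i * W $ (N - i) = 0" if "i \<le> N" for i
  proof (cases "9 dvd N - i")
    case True
    then obtain k where "N - i = 9 * k" by (elim dvdE)
    then have k: "N = i + 9 * k" using that by simp
    have "N mod 9 = i mod 9" unfolding k by simp
    moreover have "N mod 3 = i mod 3"
      using mod_mult_self2[of i 3 "3 * k"] unfolding k by simp
    ultimately have "i mod 3 = 2" "i mod 9 \<noteq> 2" using N by simp_all
    then show ?thesis using euler_1_2_square_nth_eq_0 by simp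
  qed (use W in \<open>simp add: supported_on_multiples_def\<close>)
  then have "(?C * W) $ N = 0"
    unfolding fps_mult_nth[of ?C W] by (intro sum.neutral) auto
  moreover have "3 dvd ?C $ i * B $ (N - i)" if "i \<le> N" for i
  proof (cases "3 dvd N - i")
    case True
    then obtain k where "N - i = 3 * k" by (elim dvdE)
    then have k: "N = i + 3 * k" using that by simp
    have "i mod 3 = 2" using N(1) unfolding k by simp
    then show ?thesis using euler_1_2_square_nth_dvd_3 by simp
  qed (use B in \<open>simp add: supported_on_multiples_def\<close>)
  then have "3 dvd (?C * B) $ N"
    unfolding fps_mult_nth[of ?C B] by (intro dvd_sum) auto
  then have "9 dvd 3 * (?C * B) $ N"
    using mult_dvd_mono[OF dvd_refl, of 3 "(?C * B) $ N" 3] by (simp only: mult_numeral_1 numeral_times_numeral num.simps semiring_norm)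
  ultimately show ?thesis unfolding eq by (intro dvd_add) simp_all
qed

subsection \<open>Transfer to rational power series\<close>

definition rat_fps :: "int fps \<Rightarrow> rat fps" where
  "rat_fps F = Abs_fps (\<lambda>n. of_int (F $ n))"

lemma rat_fps_nth [simp]: "rat_fps F $ n = of_int (F $ n)"
  by (simp add: rat_fps_def)

lemma rat_fps_1 [simp]: "rat_fps 1 = 1"
  by (intro fps_ext) simp

lemma rat_fps_diff: "rat_fps (F - G) = rat_fps F - rat_fps G"
  by (intro fps_ext) simp

lemma rat_fps_mult: "rat_fps (F * G) = rat_fps F * rat_fps G"
  by (intro fps_ext) (simp add: fps_mult_nth)

lemma rat_fps_power: "rat_fps (F ^ n) = rat_fps F ^ n"
  by (induction n) (simp_all add: rat_fps_mult)

lemma rat_fps_X: "rat_fps fps_X = fps_X"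
  by (intro fps_ext) (simp add: fps_X_nth)

lemma rat_fps_q_fact: "rat_fps (q_fact q n) = q_fact (rat_fps q) n"
  by (induction n) (simp_all add: rat_fps_mult rat_fps_diff rat_fps_power del: power_Suc)

lemma rat_fps_euler: "rat_fps (euler r) = qpoch_f r"
proof (rule fps_ext)
  fix n
  have "rat_fps (euler r) $ n = rat_fps (q_fact (fps_X ^ r) n) $ n"
    by (simp add: euler_def)
  then show "rat_fps (euler r) $ n = qpoch_f r $ n"
    unfolding rat_fps_q_fact rat_fps_power rat_fps_X
    by (simp add: q_fact_def qpoch_f_def power_mult)
qed

text \<open>Inverses are unique, so the rational \<open>inverse\<close> is the image of a power of
  the integral \<open>u\<close>; in particular \<open>d k n\<close> is an integer.\<close>

lemma d_eq_of_int:
  assumes u: "euler 1 * u = 1"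
  shows "d k n = of_int ((euler 2 ^ k * u ^ (3 * k + 1)) $ n)"
proof -
  have "(euler 1 ^ (3 * k + 1)) * u ^ (3 * k + 1) = 1"
    unfolding power_mult_distrib[symmetric] u by simp
  then have "qpoch_f 1 ^ (3 * k + 1) * rat_fps (u ^ (3 * k + 1)) = 1"
    unfolding rat_fps_euler[symmetric] rat_fps_power[symmetric] rat_fps_mult[symmetric] by simp
  then have "inverse (qpoch_f 1 ^ (3 * k + 1)) = rat_fps (u ^ (3 * k + 1))"
    by (rule fps_inverse_unique)
  then have "d_gen k = rat_fps (euler 2 ^ k * u ^ (3 * k + 1))"
    unfolding d_gen_def rat_fps_mult rat_fps_power rat_fps_euler by simp
  then show ?thesis by (simp add: d_def)
qed

theorem theorem4p6:
  fixes j n :: nat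
  shows "(\<exists>m::int. d (9 * j + 2) (9 * n + 5) = 9 * of_int m)
       \<and> (\<exists>m::int. d (9 * j + 2) (9 * n + 8) = 9 * of_int m)"
proof -
  obtain u where u: "euler 1 * u = 1"
    using unit_fps_int[OF euler_nth_0] by blast
  have *: "\<exists>m::int. d (9 * j + 2) N = 9 * of_int m" if N: "N mod 3 = 2" "N mod 9 \<noteq> 2" for N
  proof -
    obtain m where "(euler 2 ^ (9 * j + 2) * u ^ (3 * (9 * j + 2) + 1)) $ N = 9 * m"
      using int_coefficients_dvd_9[OF u N, of j] by (elim dvdE)
    then have "d (9 * j + 2) N = 9 * of_int m"
      unfolding d_eq_of_int[OF u] by simp
    then show ?thesis ..
  qed
  \<comment> \<open>The classes 5 and 8 are the residues modulo 9, other than 2, that are 2 modulo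
    3.\<close>
  have "(9 * n + 5) mod 3 = 2" "(9 * n + 5) mod 9 \<noteq> 2"
    "(9 * n + 8) mod 3 = 2" "(9 * n + 8) mod 9 \<noteq> 2" by presburger+
  then show ?thesis by (intro conjI *)
qed

end
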